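(* For every pair $(g,r)$ of positive integers, there is a finite poset $P=P(g,r)$ with cover graph $G=G(g,r)$ such that the height of $P$ is $r$, the girth of $G$ is at least $g$, and $\chi(G)=r$. Furthermore, there are two linear extensions $L_1$ and $L_2$ of $P$ witnessing that $\mathrm{eye}(G)\le 2$, i.e., for any three distinct vertices $x,y,z$ of $G$ with $\{y,z\}$ an edge of $G$, there is some $i\in\{1,2\}$ such that $x$ is not between $y$ and $z$ in $L_i$.
   Context: For a poset $P$ and $x,y\in P$ with $x>y$, we say $x$ covers $y$ if there is no $z$ with $x>z>y$. The cover graph of $P$ has the elements of $P$ as vertices, with $\{x,y\}$ an edge when one of $x,y$ covers the other. The height of $P$ is the maximum size of a chain in $P$. The girth of a graph is the length of a shortest cycle, and $\chi(G)$ is the chromatic number. The eye parameter $\mathrm{eye}(G)$ of a graph $G$ is the least positive integer $s$ for which there exist linear orders $L_1,\dots,L_s$ on the vertex set of $G$ such that whenever $x,y,z$ are distinct vertices with $\{y,z\}$ an edge of $G$, there is some $i$ for which $x$ is not between $y$ and $z$ in $L_i$ (so $x$ is either above both or below both of $y,z$ in $L_i$). *)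

theory Defs
  imports Main "HOL-Library.Extended_Nat"
begin

text \<open>
  A finite poset is a finite set \<open>A\<close> with a reflexive order \<open>R\<close> satisfying
  \<open>partial_order_on A R\<close>; here \<open>(x, y) \<in> R\<close> reads \<open>x \<le> y\<close>.
  A simple graph is a vertex set \<open>V\<close> with a set \<open>E\<close> of two-element edges \<open>{x, y}\<close>.
\<close>

definition poset_covers :: "'a set \<Rightarrow> 'a rel \<Rightarrow> 'a \<Rightarrow> 'a \<Rightarrow> bool" where
  "poset_covers A R x y \<longleftrightarrow> x \<in> A \<and> y \<in> A \<and> (y, x) \<in> R - Id \<and>
     \<not> (\<exists>z\<in>A. (y, z) \<in> R - Id \<and> (z, x) \<in> R - Id)"

definition cover_edges :: "'a set \<Rightarrow> 'a rel \<Rightarrow> 'a set set" where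
  "cover_edges A R = {{x, y} | x y. poset_covers A R x y}"

text \<open>The maximum exists because the poset is finite; \<open>Chains\<close> includes the empty chain.\<close>

definition poset_height :: "'a set \<Rightarrow> 'a rel \<Rightarrow> nat" where
  "poset_height A R = Max (card ` {C \<in> Chains R. C \<subseteq> A})"

definition linear_extension :: "'a set \<Rightarrow> 'a rel \<Rightarrow> 'a rel \<Rightarrow> bool" where
  "linear_extension A R L \<longleftrightarrow> linear_order_on A L \<and> R \<subseteq> L"

definition graph_cycle :: "'a set \<Rightarrow> 'a set set \<Rightarrow> 'a list \<Rightarrow> bool" where
  "graph_cycle V E c \<longleftrightarrow> 3 \<le> length c \<and> distinct c \<and> set c \<subseteq> V \<and>
     (\<forall>i<length c. {c ! i, c ! (Suc i mod length c)} \<in> E)"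

text \<open>An acyclic graph has girth \<open>\<infinity>\<close>, the infimum of the empty set.\<close>

definition girth :: "'a set \<Rightarrow> 'a set set \<Rightarrow> enat" where
  "girth V E = (INF c\<in>{c. graph_cycle V E c}. enat (length c))"

definition proper_colouring :: "'a set \<Rightarrow> 'a set set \<Rightarrow> nat \<Rightarrow> ('a \<Rightarrow> nat) \<Rightarrow> bool" where
  "proper_colouring V E k f \<longleftrightarrow> f ` V \<subseteq> {..<k} \<and>
     (\<forall>x\<in>V. \<forall>y\<in>V. {x, y} \<in> E \<longrightarrow> f x \<noteq> f y)"

definition chromatic_number :: "'a set \<Rightarrow> 'a set set \<Rightarrow> nat" where
  "chromatic_number V E = (LEAST k. \<exists>f. proper_colouring V E k f)"

text \<open>
  \<open>x\<close> lies between \<open>y\<close> and \<open>z\<close> in the reflexive linear order \<open>L\<close>; only applied to distinct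
  \<open>x\<close>, \<open>y\<close>, \<open>z\<close>, where it is strict betweenness.
\<close>

definition between_in :: "'a rel \<Rightarrow> 'a \<Rightarrow> 'a \<Rightarrow> 'a \<Rightarrow> bool" where
  "between_in L x y z \<longleftrightarrow> (y, x) \<in> L \<and> (x, z) \<in> L \<or> (z, x) \<in> L \<and> (x, y) \<in> L"

definition eye_witness :: "'a set \<Rightarrow> 'a set set \<Rightarrow> 'a rel list \<Rightarrow> bool" where
  "eye_witness V E Ls \<longleftrightarrow> (\<forall>L\<in>set Ls. linear_order_on V L) \<and>
     (\<forall>x\<in>V. \<forall>y\<in>V. \<forall>z\<in>V. distinct [x, y, z] \<and> {y, z} \<in> E \<longrightarrow>
        (\<exists>L\<in>set Ls. \<not> between_in L x y z))"

definition eye :: "'a set \<Rightarrow> 'a set set \<Rightarrow> nat" where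
  "eye V E = (LEAST s. 0 < s \<and> (\<exists>Ls. length Ls = s \<and> eye_witness V E Ls))"

end

theory Submission
  imports Defs "HOL-Library.Nat_Bijection" "HOL-Library.Infinite_Set"
begin

text \<open>
  Two linear extensions witness \<open>eye \<le> 2\<close> exactly when, drawing the vertices as points with the
  two orders as coordinates, no vertex lies in the rectangle spanned by an edge. Such drawings are
  built by induction on \<open>r\<close>, in the manner of Tutte. Let \<open>n\<close> be the number of vertices for \<open>r\<close>, and
  take an \<open>n\<close>-uniform hypergraph without short cycles in which every colouring with \<open>r\<close> colours has
  a monochromatic edge. Its vertices become new maximal points, and for every hyperedge \<open>M\<close> a new
  copy of the graph is matched to the points of \<open>M\<close>. In a colouring with \<open>r\<close> colours, the copy at a
  monochromatic hyperedge would use only \<open>r - 1\<close> colours. The hypergraphs come from the partite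
  construction of Nesetril and Roedl; both constructions glue sparse pieces along a sparse
  hypergraph, which creates no short cycle.
\<close>

section \<open>Hypergraphs without short cycles\<close>

text \<open>In a cycle every edge meets its neighbours in two different vertices, so none is a leaf.
  Two edges with two common vertices count as a cycle of length 2.\<close>

definition leaf_edge :: "'a set set \<Rightarrow> 'a set \<Rightarrow> bool" where
  "leaf_edge F e \<longleftrightarrow> e \<in> F \<and> (\<exists>x. e \<inter> \<Union>(F - {e}) \<subseteq> {x})"

text \<open>This says that there is no Berge cycle of length at most \<open>p\<close>;
  asking for two leaves, as in a forest, is what makes the property survive gluing.\<close>

definition sparse :: "nat \<Rightarrow> 'a set set \<Rightarrow> bool" where
  "sparse p E \<longleftrightarrow> (\<forall>F\<subseteq>E. finite F \<and> 2 \<le> card F \<and> card F \<le> p \<longrightarrow>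
     (\<exists>e e'. e \<noteq> e' \<and> leaf_edge F e \<and> leaf_edge F e'))"

lemma sparseD:
  assumes "sparse p E" "F \<subseteq> E" "finite F" "2 \<le> card F" "card F \<le> p"
  obtains e e' where "e \<noteq> e'" "leaf_edge F e" "leaf_edge F e'"
  using assms unfolding sparse_def by metis

lemma two_elements:
  assumes "2 \<le> card F"
  obtains e e' where "e \<in> F" "e' \<in> F" "e \<noteq> e'"
proof -
  obtain T where "T \<subseteq> F" "card T = 2"
    using obtain_subset_with_card_n[OF assms] by blast
  then show thesis using that by (auto simp: card_2_iff)
qed

lemma sparse_mono: "sparse p E \<Longrightarrow> E' \<subseteq> E \<Longrightarrow> sparse p E'"
  unfolding sparse_def by (meson subset_trans)

text \<open>The root \<open>z\<close> stands for the vertex where \<open>F\<close> is glued to edges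
  outside it. It spoils at most one of two leaves: if it lies in both, it is a vertex that each
  shares with the rest of \<open>F\<close>, so it is already their attachment vertex.\<close>

lemma sparse_rooted_leaf:
  assumes "sparse p E" "F \<subseteq> E" "finite F" "F \<noteq> {}" "card F \<le> p"
  obtains e x where "e \<in> F" "e \<inter> (\<Union>(F - {e}) \<union> {z}) \<subseteq> {x}"
proof (cases "2 \<le> card F")
  case True
  then obtain e e' where ne: "e \<noteq> e'" and l: "leaf_edge F e" "leaf_edge F e'"
    using assms by (meson sparseD)
  then obtain x x' where x: "e \<in> F" "e' \<in> F" "e \<inter> \<Union>(F - {e}) \<subseteq> {x}" "e' \<inter> \<Union>(F - {e'}) \<subseteq> {x'}"
    unfolding leaf_edge_def by blast
  show thesis
  proof (cases "z \<in> e \<and> z \<in> e'")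
    case True
    then have "z \<in> e \<inter> \<Union>(F - {e})" using x ne by blast
    then have "x = z" using x by blast
    then show thesis using that[of e z] x by blast
  next
    case False
    then show thesis
    proof (cases "z \<in> e")
      case True
      then have "z \<notin> e'" using False by blast
      then show thesis using that[of e' x'] x by blast
    next
      case False
      then show thesis using that[of e x] x by blast
    qed
  qed
next
  case False
  moreover have "card F \<noteq> 0" using assms by auto
  ultimately have "card F = 1" by linarith
  then obtain e where "F = {e}" by (auto simp: card_1_singleton_iff)
  then show thesis using that[of e z] by auto
qed

lemma sparse_image:
  assumes "sparse p E" "inj_on f (\<Union>E)"
  shows "sparse p ((`) f ` E)"
  unfolding sparse_def
proof (intro allI impI)
  fix F assume F: "F \<subseteq> (`) f ` E" "finite F \<and> 2 \<le> card F \<and> card F \<le> p"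
  define G where "G = {e \<in> E. f ` e \<in> F}"
  have inj: "inj_on ((`) f) E"
    using assms(2) by (auto intro!: inj_onI simp: inj_on_image_eq_iff Union_upper)
  have FG: "F = (`) f ` G" using F(1) unfolding G_def by blast
  have GE: "G \<subseteq> E" unfolding G_def by blast
  have injG: "inj_on ((`) f) G" using inj GE by (rule inj_on_subset)
  then have "card F = card G" "finite G"
    using FG F(2) by (auto simp: card_image finite_image_iff)
  then obtain e e' where ne: "e \<noteq> e'" and l: "leaf_edge G e" "leaf_edge G e'"
    using F(2) GE assms(1) by (metis sparseD)
  have leaf: "leaf_edge F (f ` e)" if "leaf_edge G e" for e
  proof -
    obtain x where e: "e \<in> G" "e \<inter> \<Union>(G - {e}) \<subseteq> {x}" using \<open>leaf_edge G e\<close> unfolding leaf_edge_def by auto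
    have "f ` e \<inter> \<Union>(F - {f ` e}) \<subseteq> {f x}"
    proof
      fix y assume "y \<in> f ` e \<inter> \<Union>(F - {f ` e})"
      then obtain u d v where "u \<in> e" "y = f u" "d \<in> G" "d \<noteq> e" "v \<in> d" "y = f v" using FG by blast
      moreover from this have "u = v"
        using assms(2) GE e(1) by (meson UnionI inj_onD subsetD)
      ultimately show "y \<in> {f x}" using e by blast
    qed
    then show ?thesis using e FG unfolding leaf_edge_def by blast
  qed
  have "f ` e \<noteq> f ` e'" using ne l injG unfolding leaf_edge_def by (auto dest: inj_onD)
  then show "\<exists>e e'. e \<noteq> e' \<and> leaf_edge F e \<and> leaf_edge F e'" using leaf l by blast
qed

lemma sparse_disjoint:
  assumes "\<And>e e'. e \<in> E \<Longrightarrow> e' \<in> E \<Longrightarrow> e \<noteq> e' \<Longrightarrow> e \<inter> e' = {}"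
  shows "sparse p E"
  unfolding sparse_def
proof (intro allI impI)
  fix F assume F: "F \<subseteq> E" "finite F \<and> 2 \<le> card F \<and> card F \<le> p"
  obtain e e' where "e \<in> F" "e' \<in> F" "e \<noteq> e'" using F two_elements by blast
  moreover have "leaf_edge F e" if "e \<in> F" for e
    using that assms F unfolding leaf_edge_def by fast
  ultimately show "\<exists>e e'. e \<noteq> e' \<and> leaf_edge F e \<and> leaf_edge F e'" by blast
qed

text \<open>A cycle through several pieces runs, in each piece, between two distinct vertices of its
  attachment set and so uses at least two edges there; the pieces therefore form a shorter cycle
  in the hypergraph of attachment sets.\<close>

lemma sparse_amalgam:
  fixes A :: "'i \<Rightarrow> 'a set" and C :: "'i \<Rightarrow> 'a set set"
  assumes meet: "\<And>i j e e'. i \<in> I \<Longrightarrow> j \<in> I \<Longrightarrow> i \<noteq> j \<Longrightarrow> e \<in> C i \<Longrightarrow> e' \<in> C j \<Longrightarrow> e \<inter> e' \<subseteq> A i \<inter> A j"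
    and piece: "\<And>i. i \<in> I \<Longrightarrow> sparse p (C i)"
    and once: "\<And>i e. i \<in> I \<Longrightarrow> e \<in> C i \<Longrightarrow> \<exists>x. e \<inter> A i \<subseteq> {x}"
    and inj: "inj_on A I"
    and base: "sparse q (A ` I)" and pq: "p \<le> Suc q"
  shows "sparse p (\<Union>i\<in>I. C i)"
  unfolding sparse_def
proof (intro allI impI)
  fix F assume F: "F \<subseteq> (\<Union>i\<in>I. C i)" "finite F \<and> 2 \<le> card F \<and> card F \<le> p"
  \<comment> \<open>An edge may belong to several pieces; one is chosen for each.\<close>
  define idx where "idx e = (SOME i. i \<in> I \<and> e \<in> C i)" for e
  have idx: "idx e \<in> I" "e \<in> C (idx e)" if "e \<in> F" for e
  proof -
    have "\<exists>i. i \<in> I \<and> e \<in> C i" using that F by blast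
    then have "idx e \<in> I \<and> e \<in> C (idx e)" unfolding idx_def by (rule someI_ex)
    then show "idx e \<in> I" "e \<in> C (idx e)" by auto
  qed
  define J where "J = idx ` F"
  have JI: "J \<subseteq> I" using idx J_def by blast
  have finJ: "finite J" using F J_def by blast
  show "\<exists>e e'. e \<noteq> e' \<and> leaf_edge F e \<and> leaf_edge F e'"
  proof (cases "inj_on idx F")
    case True
    \<comment> \<open>With at most one edge per piece, an edge meets all others inside its own
      attachment set, hence in at most one vertex by \<open>once\<close>.\<close>
    have leaf: "leaf_edge F e" if e: "e \<in> F" for e
    proof -
      obtain x where x: "e \<inter> A (idx e) \<subseteq> {x}" using once idx e by blast
      have "e \<inter> e' \<subseteq> A (idx e)" if "e' \<in> F - {e}" for e'
        using that e idx meet[of "idx e" "idx e'" e e'] True by (auto dest: inj_onD)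
      then have "e \<inter> \<Union>(F - {e}) \<subseteq> e \<inter> A (idx e)" by blast
      then show ?thesis using x e unfolding leaf_edge_def by blast
    qed
    obtain e e' where "e \<in> F" "e' \<in> F" "e \<noteq> e'" using F two_elements by blast
    then show ?thesis using leaf by blast
  next
    case False
    \<comment> \<open>Some piece holds two edges of \<open>F\<close>, so fewer pieces than edges are
      involved. This accounts for the \<open>Suc\<close> in \<open>p \<le> Suc q\<close>.\<close>
    have "card J < card F"
      using False F card_image_le[of F idx] inj_on_iff_eq_card[of F idx] J_def by fastforce
    then have cJ: "card J \<le> q" using F pq by linarith
    show ?thesis
    proof (cases "2 \<le> card J")
      case True
      have cA: "card (A ` J) = card J" using inj JI by (meson card_image inj_on_subset)
      obtain M M' where MM: "M \<noteq> M'" "leaf_edge (A ` J) M" "leaf_edge (A ` J) M'"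
        using sparseD[OF base, of "A ` J"] JI finJ cA cJ True by (metis finite_imageI image_mono)
      \<comment> \<open>If \<open>M\<close> is a leaf, edges from other pieces meet those of its
        piece only in \<open>z\<close>. A leaf of the piece rooted at \<open>z\<close> is therefore
        a leaf of \<open>F\<close>, and the two leaves \<open>M\<close>, \<open>M'\<close> give two
        such edges.\<close>
      have ex: "\<exists>e\<in>F. A (idx e) = M \<and> leaf_edge F e" if M: "leaf_edge (A ` J) M" for M
      proof -
        obtain i z where i: "i \<in> J" "M = A i" and z: "M \<inter> \<Union>(A ` J - {M}) \<subseteq> {z}"
          using M unfolding leaf_edge_def by blast
        define G where "G = {e \<in> F. idx e = i}"
        have G: "G \<subseteq> C i" "finite G" "G \<noteq> {}" "card G \<le> p"
          using i idx F J_def card_mono[of F G] unfolding G_def by fastforce+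
        obtain e x where e: "e \<in> G" "e \<inter> (\<Union>(G - {e}) \<union> {z}) \<subseteq> {x}"
          using sparse_rooted_leaf[OF piece G] i JI by blast
        have "e \<inter> e' \<subseteq> \<Union>(G - {e}) \<union> {z}" if e': "e' \<in> F - {e}" for e'
        proof (cases "idx e' = i")
          case True
          then show ?thesis using e' unfolding G_def by blast
        next
          case False
          have "e \<inter> e' \<subseteq> A i \<inter> A (idx e')"
            using meet[of i "idx e'" e e'] False e e' idx i JI unfolding G_def by blast
          moreover have "A (idx e') \<in> A ` J - {M}"
            using False e' i inj JI idx J_def by (auto dest: inj_onD)
          ultimately show ?thesis using z i by blast
        qed
        then have "e \<inter> \<Union>(F - {e}) \<subseteq> {x}" using e by blast
        then show ?thesis using e i unfolding G_def leaf_edge_def by blast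
      qed
      obtain e e' where "A (idx e) = M" "leaf_edge F e" "A (idx e') = M'" "leaf_edge F e'"
        using ex MM by meson
      moreover from this have "e \<noteq> e'" using MM(1) by auto
      ultimately show ?thesis by auto
    next
      case False
      moreover have "card J \<noteq> 0" using F finJ J_def by auto
      ultimately have "card J = 1" by linarith
      then obtain i where i: "J = {i}" by (auto simp: card_1_singleton_iff)
      then have "idx e = i" if "e \<in> F" for e using that unfolding J_def by blast
      then have "F \<subseteq> C i" using idx(2) by auto
      moreover have "sparse p (C i)" using piece i JI by blast
      ultimately show ?thesis using F by (meson sparseD)
    qed
  qed
qed

text \<open>\<open>t v\<close> lies on no other edge, so a pendant edge is a leaf attached at
  \<open>f v\<close>. Two pendant edges suffice; if \<open>F\<close> has just one, the remaining
  edges lie in \<open>E\<close>, and a leaf of theirs rooted at \<open>f v\<close> is the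
  second.\<close>

lemma sparse_pendant:
  assumes E: "sparse p E" and inj: "inj_on t W"
    and new: "\<And>v. v \<in> W \<Longrightarrow> t v \<notin> \<Union>E" "\<And>u v. u \<in> W \<Longrightarrow> v \<in> W \<Longrightarrow> t v \<noteq> f u"
  shows "sparse p (E \<union> (\<lambda>v. {f v, t v}) ` W)"
  unfolding sparse_def
proof (intro allI impI)
  let ?D = "(\<lambda>v. {f v, t v}) ` W"
  fix F assume F: "F \<subseteq> E \<union> ?D" "finite F \<and> 2 \<le> card F \<and> card F \<le> p"
  have pend: "leaf_edge F d" if d: "d \<in> F" "d \<in> ?D" for d
  proof -
    obtain v where v: "v \<in> W" "d = {f v, t v}" using d by blast
    have "t v \<notin> e" if "e \<in> F - {d}" for e
    proof
      assume tv: "t v \<in> e"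
      then have "e \<in> ?D" using that F new(1) v by blast
      then obtain u where u: "u \<in> W" "e = {f u, t u}" by blast
      then have "t v = t u" using tv new(2) v by blast
      then show False using inj u v that by (auto dest: inj_onD)
    qed
    then have "d \<inter> \<Union>(F - {d}) \<subseteq> {f v}" using v by blast
    then show ?thesis using d unfolding leaf_edge_def by blast
  qed
  show "\<exists>e e'. e \<noteq> e' \<and> leaf_edge F e \<and> leaf_edge F e'"
  proof (cases "\<exists>d\<in>F. d \<in> ?D")
    case False
    then have "F \<subseteq> E" using F by blast
    then show ?thesis using E F by (meson sparseD)
  next
    case True
    then obtain d v where d: "d \<in> F" "v \<in> W" "d = {f v, t v}" by blast
    show ?thesis
    proof (cases "\<exists>d'\<in>F. d' \<in> ?D \<and> d' \<noteq> d")
      case True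
      then obtain d' where d': "d' \<in> F" "d' \<in> ?D" "d' \<noteq> d" by auto
      have "leaf_edge F d" using pend d by auto
      moreover have "leaf_edge F d'" using pend d' by auto
      ultimately show ?thesis using d'(3) by auto
    next
      case False
      then have FE: "F - {d} \<subseteq> E" using F by blast
      have "card (F - {d}) = card F - 1" using d F by simp
      then have c: "F - {d} \<noteq> {}" "card (F - {d}) \<le> p" "finite (F - {d})" using F by fastforce+
      obtain e x where e: "e \<in> F - {d}" "e \<inter> (\<Union>(F - {d} - {e}) \<union> {f v}) \<subseteq> {x}"
        using sparse_rooted_leaf[OF E FE c(3,1,2)] by blast
      have "t v \<notin> e" using e FE new(1) d by blast
      then have "e \<inter> \<Union>(F - {e}) \<subseteq> {x}" using e d by blast
      then have "leaf_edge F e" using e unfolding leaf_edge_def by blast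
      moreover have "leaf_edge F d" using pend d by blast
      ultimately show ?thesis using e by blast
    qed
  qed
qed

text \<open>The edges of a graph cycle form a family without leaves, since each edge shares its two
  ends with its two neighbours. Sparsity therefore forces a length above \<open>p\<close>.\<close>

lemma sparse_imp_girth:
  assumes "sparse p E"
  shows "enat (Suc p) \<le> girth V E"
  unfolding girth_def
proof (rule INF_greatest)
  fix c assume "c \<in> {c. graph_cycle V E c}"
  then have c: "3 \<le> length c" "distinct c" "\<And>i. i < length c \<Longrightarrow> {c ! i, c ! (Suc i mod length c)} \<in> E"
    unfolding graph_cycle_def by auto
  define n where "n = length c"
  define ed where "ed i = {c ! i, c ! (Suc i mod n)}" for i
  have sucn: "Suc i mod n < n" for i using c n_def by (intro mod_less_divisor) linarith
  have nth: "c ! i = c ! j \<longleftrightarrow> i = j" if "i < n" "j < n" for i j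
    using that c n_def nth_eq_iff_index_eq by blast
  have sc: "Suc i mod n = (if Suc i = n then 0 else Suc i)" if "i < n" for i
    using that by auto
  \<comment> \<open>Length at least 3 makes consecutive edges different, so both neighbours of an
    edge survive its removal from the family.\<close>
  have ne: "ed i \<noteq> ed (Suc i mod n)" if "i < n" for i
  proof -
    have "Suc (Suc i mod n) mod n \<noteq> i" "Suc i mod n \<noteq> i"
      using that c n_def sc[OF that] sc[OF sucn[of i]] by (auto split: if_splits)
    then show ?thesis using that sucn nth unfolding ed_def by (metis doubleton_eq_iff)
  qed
  have no_leaf: "\<not> leaf_edge (ed ` {..<n}) e" for e
  proof
    assume "leaf_edge (ed ` {..<n}) e"
    then obtain i x where i: "i < n" "e = ed i" and x: "e \<inter> \<Union>(ed ` {..<n} - {e}) \<subseteq> {x}"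
      unfolding leaf_edge_def by blast
    define j where "j = (if i = 0 then n - 1 else i - 1)"
    have j: "j < n" "Suc j mod n = i" using i unfolding j_def by auto
    have "ed j \<noteq> e" using ne[OF j(1)] j i by simp
    moreover have "c ! i \<in> ed j" using j unfolding ed_def by simp
    ultimately have "c ! i = x" using x j i unfolding ed_def by blast
    moreover have "c ! (Suc i mod n) = x"
      using x ne[OF i(1)] sucn i unfolding ed_def by blast
    ultimately have "i = Suc i mod n" using nth i sucn by metis
    then show False using sc i c n_def by (auto split: if_splits)
  qed
  show "enat (Suc p) \<le> enat (length c)"
  proof (rule ccontr)
    assume "\<not> enat (Suc p) \<le> enat (length c)"
    then have "n \<le> p" unfolding n_def by simp
    then have "card (ed ` {..<n}) \<le> p" using card_image_le[of "{..<n}" ed] by simp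
    moreover have "2 \<le> card (ed ` {..<n})"
    proof -
      have "{ed 0, ed 1} \<subseteq> ed ` {..<n}" using c n_def by auto
      moreover have "0 < n" "Suc 0 \<noteq> n" using c n_def by auto
      then have "ed 0 \<noteq> ed 1" using ne[of 0] sc[of 0] by simp
      ultimately show ?thesis using card_mono[of "ed ` {..<n}" "{ed 0, ed 1}"] by simp
    qed
    moreover have "ed ` {..<n} \<subseteq> E" using c(3) unfolding ed_def n_def by blast
    ultimately show False using sparseD[OF assms] no_leaf by (metis finite_imageI finite_lessThan)
  qed
qed

section \<open>Sparse hypergraphs of large chromatic number\<close>

text \<open>Otherwise no colour class has more than \<open>k\<close> elements, so \<open>A\<close>
  has at most \<open>k * n\<close>. The summand \<open>k\<close> in the bound contradicts this
  unless \<open>k = 0\<close>, where the empty set serves.\<close>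

lemma pigeonhole_subset:
  assumes "finite A" "card (d ` A) \<le> n" "k * n + k \<le> card A"
  obtains S where "S \<subseteq> A" "card S = k" "\<exists>a. \<forall>i\<in>S. d i = a"
proof (cases "k = 0")
  case True
  then show thesis using that[of "{}"] by simp
next
  case False
  have "\<exists>a\<in>d ` A. k \<le> card {i \<in> A. d i = a}"
  proof (rule ccontr)
    assume "\<not> ?thesis"
    then have "card {i \<in> A. d i = a} \<le> k" if "a \<in> d ` A" for a using that by force
    then have "(\<Sum>a\<in>d ` A. card {i \<in> A. d i = a}) \<le> card (d ` A) * k"
      using sum_bounded_above[of "d ` A" "\<lambda>a. card {i \<in> A. d i = a}" k] by simp
    moreover have "card A = (\<Sum>a\<in>d ` A. card {i \<in> A. d i = a})"
    proof -
      have "A = (\<Union>a\<in>d ` A. {i \<in> A. d i = a})" by blast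
      moreover have "card (\<Union>a\<in>d ` A. {i \<in> A. d i = a}) = (\<Sum>a\<in>d ` A. card {i \<in> A. d i = a})"
        using assms(1) by (intro card_UN_disjoint) auto
      ultimately show ?thesis by simp
    qed
    moreover have "card (d ` A) * k \<le> k * n" using assms(2) by simp
    ultimately show False using assms(3) False by linarith
  qed
  then obtain a where "k \<le> card {i \<in> A. d i = a}" by blast
  then obtain S where "S \<subseteq> {i \<in> A. d i = a}" "card S = k" by (meson obtain_subset_with_card_n)
  then show thesis using that[of S] by blast
qed

section \<open>The partite construction\<close>

definition mono_edge :: "nat set set \<Rightarrow> (nat \<Rightarrow> nat) \<Rightarrow> bool" where
  "mono_edge E c \<longleftrightarrow> (\<exists>e\<in>E. \<exists>a. \<forall>v\<in>e. c v = a)"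

definition uniform_hypergraph :: "nat \<Rightarrow> nat set \<Rightarrow> nat set set \<Rightarrow> bool" where
  "uniform_hypergraph k V E \<longleftrightarrow> finite V \<and> (\<forall>e\<in>E. e \<subseteq> V \<and> card e = k)"

text \<open>Only colourings that are constant on the parts numbered \<open>j\<close> or more are considered; at
  \<open>j = 0\<close> the pigeonhole principle applies, and at \<open>j = a\<close> the restriction is void.\<close>

definition partite_system ::
  "nat \<Rightarrow> nat \<Rightarrow> nat \<Rightarrow> nat \<Rightarrow> nat \<Rightarrow> nat set \<Rightarrow> nat set set \<Rightarrow> (nat \<Rightarrow> nat) \<Rightarrow> bool" where
  "partite_system k n p a j V E part \<longleftrightarrow>
     uniform_hypergraph k V E \<and> sparse p E \<and> (\<forall>e\<in>E. inj_on part e) \<and> part ` V \<subseteq> {..<a} \<and>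
     (\<forall>c. card (c ` V) \<le> n \<longrightarrow>
        (\<forall>u\<in>V. \<forall>v\<in>V. part u = part v \<longrightarrow> j \<le> part u \<longrightarrow> c u = c v) \<longrightarrow> mono_edge E c)"

text \<open>The edges are disjoint copies of all \<open>k\<close>-subsets of the part numbers, the
  copy of \<open>i\<close> lying in part \<open>i\<close>. Disjointness gives sparsity for every
  \<open>p\<close>, and a colouring constant on the parts is a colouring of \<open>k * n + k\<close>
  numbers.\<close>

lemma partite_start:
  obtains V E part where "partite_system k n p (k * n + k) 0 V E part"
proof -
  let ?a = "k * n + k"
  define SS where "SS = {S. S \<subseteq> {..<?a} \<and> card S = k}"
  define vx where "vx S i = prod_encode (set_encode S, i)" for S i
  define part where "part = (\<lambda>w. snd (prod_decode w))"
  define E where "E = (\<lambda>S. vx S ` S) ` SS"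
  have part: "part (vx S i) = i" for S i unfolding part_def vx_def by simp
  have fin: "finite S" if "S \<in> SS" for S using that finite_subset unfolding SS_def by blast
  have finS: "finite SS" unfolding SS_def by (rule finite_subset[of _ "Pow {..<?a}"]) auto
  have vx_eq: "S = T" if "vx S i = vx T j" "S \<in> SS" "T \<in> SS" for S T i j
    using that fin inj_on_set_encode unfolding vx_def by (auto dest!: inj_onD)
  have inj: "inj_on (vx S) S" for S by (metis part inj_onI)
  have "uniform_hypergraph k (\<Union>E) E"
    unfolding uniform_hypergraph_def E_def using fin finS inj
    by (auto simp: card_image SS_def)
  moreover have "sparse p E"
    by (rule sparse_disjoint) (use vx_eq in \<open>unfold E_def, blast\<close>)
  moreover have "\<forall>e\<in>E. inj_on part e" unfolding E_def by (auto intro!: inj_onI simp: part)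
  moreover have "part ` \<Union>E \<subseteq> {..<?a}" unfolding E_def SS_def by (auto simp: part)
  moreover have "mono_edge E c"
    if c: "card (c ` \<Union>E) \<le> n" "\<forall>u\<in>\<Union>E. \<forall>v\<in>\<Union>E. part u = part v \<longrightarrow> c u = c v" for c
  proof -
    \<comment> \<open>The common colour of part \<open>i\<close>, well defined because
      \<open>c\<close> is constant on parts.\<close>
    define d where "d i = c (SOME v. v \<in> \<Union>E \<and> part v = i)" for i
    have d: "d i = c (vx S i)" "d i \<in> c ` \<Union>E" if "S \<in> SS" "i \<in> S" for S i
    proof -
      have v: "vx S i \<in> \<Union>E" "part (vx S i) = i" using that part unfolding E_def by blast+
      then have "\<exists>v. v \<in> \<Union>E \<and> part v = i" by blast
      from someI_ex[OF this] have w: "(SOME v. v \<in> \<Union>E \<and> part v = i) \<in> \<Union>E"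
        "part (SOME v. v \<in> \<Union>E \<and> part v = i) = i" by blast+
      show "d i \<in> c ` \<Union>E" using w(1) unfolding d_def by (rule imageI)
      show "d i = c (vx S i)" unfolding d_def using c(2) v w by metis
    qed
    show ?thesis
    proof (cases "k = 0")
      case True
      then have "{} \<in> SS" unfolding SS_def by simp
      then show ?thesis unfolding mono_edge_def E_def by force
    next
      case False
      have "d i \<in> c ` \<Union>E" if i: "i < ?a" for i
      proof -
        \<comment> \<open>Every part number lies in some \<open>k\<close>-subset, so each part is
          inhabited and \<open>d i\<close> is a colour of \<open>c\<close> rather than an arbitrary
          default.\<close>
        have "\<exists>S. {i} \<subseteq> S \<and> S \<subseteq> {..<?a} \<and> card S = k"
          by (rule exists_subset_between) (use i False in auto)
        then show ?thesis using d unfolding SS_def by blast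
      qed
      moreover have "finite (c ` \<Union>E)" using fin finS unfolding E_def by auto
      ultimately have "card (d ` {..<?a}) \<le> n"
        using c(1) card_mono[of "c ` \<Union>E" "d ` {..<?a}"] by fastforce
      then obtain S a where S: "S \<subseteq> {..<?a}" "card S = k" "\<forall>i\<in>S. d i = a"
        using pigeonhole_subset[of "{..<?a}" d n k] by (metis card_lessThan finite_lessThan order_refl)
      then have "S \<in> SS" unfolding SS_def by blast
      then have "\<forall>v\<in>vx S ` S. c v = a" "vx S ` S \<in> E" using d S E_def by auto
      then show ?thesis unfolding mono_edge_def by blast
    qed
  qed
  ultimately have "partite_system k n p ?a 0 (\<Union>E) E part"
    unfolding partite_system_def by (simp only: le0 simp_thms) iprover
  then show thesis by (rule that)
qed

text \<open>Colours are counted in the image rather than taken from \<open>{..<n}\<close>, so a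
  colouring can be composed with a map into its vertex set without renaming colours.\<close>

definition ramsey_hypergraph :: "nat \<Rightarrow> nat \<Rightarrow> nat \<Rightarrow> nat set \<Rightarrow> nat set set \<Rightarrow> bool" where
  "ramsey_hypergraph k p n V E \<longleftrightarrow> uniform_hypergraph k V E \<and> sparse p E \<and>
     (\<forall>c. card (c ` V) \<le> n \<longrightarrow> mono_edge E c)"

text \<open>Every hyperedge \<open>M\<close> of a \<open>card X\<close>-uniform Ramsey hypergraph
  receives a copy of the system with part \<open>j\<close> identified with \<open>M\<close>, the
  other parts being kept disjoint. A colouring constant on the parts beyond \<open>j\<close> makes
  some \<open>M\<close> monochromatic, so on that copy it is constant on part \<open>j\<close> too.
  \<open>IH\<close> covers every uniformity because \<open>card X\<close> is unrelated to
  \<open>k\<close>.\<close>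

lemma partite_step:
  assumes IH: "\<And>k. \<exists>V E. ramsey_hypergraph k p n V E"
    and "partite_system k n (Suc p) a j V E part" and ja: "j < a"
  obtains V' E' part' where "partite_system k n (Suc p) a (Suc j) V' E' part'"
proof -
  have P: "uniform_hypergraph k V E" "sparse (Suc p) E" "\<forall>e\<in>E. inj_on part e" "part ` V \<subseteq> {..<a}"
    "\<And>c. card (c ` V) \<le> n \<Longrightarrow> (\<forall>u\<in>V. \<forall>v\<in>V. part u = part v \<longrightarrow> j \<le> part u \<longrightarrow> c u = c v) \<Longrightarrow> mono_edge E c"
    using assms(2) unfolding partite_system_def by iprover+
  define X where "X = {v \<in> V. part v = j}"
  obtain Y H where H: "uniform_hypergraph (card X) Y H" "sparse p H"
    "\<And>c. card (c ` Y) \<le> n \<Longrightarrow> mono_edge H c"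
    using IH unfolding ramsey_hypergraph_def by metis
  have finV: "finite V" and EV: "\<And>e. e \<in> E \<Longrightarrow> e \<subseteq> V" "\<And>e. e \<in> E \<Longrightarrow> card e = k"
    using P(1) unfolding uniform_hypergraph_def by auto
  have finY: "finite Y" and HY: "\<And>M. M \<in> H \<Longrightarrow> M \<subseteq> Y" "\<And>M. M \<in> H \<Longrightarrow> card M = card X"
    using H(1) unfolding uniform_hypergraph_def by auto
  have finM: "finite M" if "M \<in> H" for M using that HY finY finite_subset by blast
  have finH: "finite H" using finY HY by (meson finite_Pow_iff finite_subset Pow_iff subsetI)
  have "\<exists>f. bij_betw f X M" if "M \<in> H" for M
    using that finV finM HY unfolding X_def by (intro finite_same_card_bij) auto
  then obtain \<phi> where \<phi>: "\<And>M. M \<in> H \<Longrightarrow> bij_betw (\<phi> M) X M" by metis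
  \<comment> \<open>First component 0 marks the shared points; other vertices carry
    \<open>Suc\<close> of the code of their hyperedge. Distinct copies thus meet only in shared
    points.\<close>
  define top where "top y = prod_encode (0, y)" for y
  define \<psi> where "\<psi> M v = (if part v = j then top (\<phi> M v) else prod_encode (Suc (set_encode M), v))" for M v
  define part' where "part' w = (case prod_decode w of (s, v) \<Rightarrow> if s = 0 then j else part v)" for w
  define V' where "V' = top ` Y \<union> (\<Union>M\<in>H. \<psi> M ` V)"
  define C where "C M = (`) (\<psi> M) ` E" for M
  have part': "part' (top y) = j" "part' (\<psi> M v) = part v" for y M v
    unfolding part'_def \<psi>_def top_def by auto
  have top_inj: "inj top" unfolding top_def by (auto intro: injI)
  have \<phi>M: "\<phi> M v \<in> M" if "M \<in> H" "v \<in> V" "part v = j" for M v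
    using \<phi>[OF that(1)] that unfolding X_def bij_betw_def by blast
  have inj: "inj_on (\<psi> M) V" if "M \<in> H" for M
  proof (rule inj_onI)
    fix u v assume uv: "u \<in> V" "v \<in> V" "\<psi> M u = \<psi> M v"
    then have "part u = part v" using part' by metis
    then show "u = v"
      using uv \<phi>[OF that] unfolding \<psi>_def bij_betw_def X_def top_def
      by (auto split: if_splits dest: inj_onD)
  qed
  have same: "w \<in> top ` M \<inter> top ` M'"
    if "M \<in> H" "M' \<in> H" "M \<noteq> M'" "u \<in> V" "v \<in> V" "w = \<psi> M u" "w = \<psi> M' v" for M M' u v w
  proof -
    have "set_encode M \<noteq> set_encode M'"
      using that finM inj_on_set_encode by (auto dest: inj_onD)
    moreover have "part u = part v" using part' that by metis
    ultimately have "part u = j" "part v = j"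
      using that unfolding \<psi>_def by (auto split: if_splits)
    then have "w = top (\<phi> M u)" "w = top (\<phi> M' v)" using that unfolding \<psi>_def by auto
    moreover have "\<phi> M u \<in> M" "\<phi> M' v \<in> M'" using \<phi>M that \<open>part u = j\<close> \<open>part v = j\<close> by auto
    ultimately show ?thesis by blast
  qed
  have "sparse (Suc p) (\<Union>M\<in>H. C M)"
  proof (rule sparse_amalgam[where A = "\<lambda>M. top ` M" and q = p])
    fix M M' e e' assume M: "M \<in> H" "M' \<in> H" "M \<noteq> M'" and e: "e \<in> C M" "e' \<in> C M'"
    show "e \<inter> e' \<subseteq> top ` M \<inter> top ` M'"
    proof
      fix w assume "w \<in> e \<inter> e'"
      moreover have "e \<subseteq> \<psi> M ` V" "e' \<subseteq> \<psi> M' ` V" using e EV(1) unfolding C_def by auto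
      ultimately obtain u v where "u \<in> V" "v \<in> V" "w = \<psi> M u" "w = \<psi> M' v" by blast
      then show "w \<in> top ` M \<inter> top ` M'" by (rule same[OF M])
    qed
  next
    fix M assume "M \<in> H"
    then have "inj_on (\<psi> M) (\<Union>E)" using inj EV(1) by (meson Sup_least inj_on_subset)
    then show "sparse (Suc p) (C M)" unfolding C_def by (rule sparse_image[OF P(2)])
  next
    fix M e assume M: "M \<in> H" "e \<in> C M"
    then obtain d where d: "d \<in> E" "e = \<psi> M ` d" unfolding C_def by blast
    \<comment> \<open>An edge has at most one vertex in part \<open>j\<close>, the only part that is
      glued.\<close>
    have "u = v" if "u \<in> d" "v \<in> d" "\<psi> M u \<in> top ` M" "\<psi> M v \<in> top ` M" for u v
    proof -
      have "part u = j" "part v = j" using that part' by (metis imageE)+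
      then show ?thesis using P(3) d that by (auto dest: inj_onD)
    qed
    then have uniq: "x = y" if "x \<in> e \<inter> top ` M" "y \<in> e \<inter> top ` M" for x y
      using that unfolding d(2) by auto
    show "\<exists>x. e \<inter> top ` M \<subseteq> {x}"
    proof (cases "e \<inter> top ` M = {}")
      case False
      then obtain x where "x \<in> e \<inter> top ` M" by blast
      then show ?thesis using uniq by blast
    qed simp
  next
    show "inj_on ((`) top) H"
      using top_inj by (simp add: inj_on_def inj_image_eq_iff)
    show "sparse p ((`) top ` H)"
      by (rule sparse_image[OF H(2)]) (rule inj_on_subset[OF top_inj subset_UNIV])
  qed simp
  moreover have "uniform_hypergraph k V' (\<Union>M\<in>H. C M)"
    unfolding uniform_hypergraph_def
  proof (intro conjI ballI)
    show "finite V'" using finV finY finH unfolding V'_def by blast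
    fix e assume "e \<in> (\<Union>M\<in>H. C M)"
    then obtain M d where d: "M \<in> H" "d \<in> E" "e = \<psi> M ` d" unfolding C_def by blast
    then show "e \<subseteq> V'" using EV unfolding V'_def by blast
    show "card e = k" using d EV inj by (metis card_image inj_on_subset)
  qed
  moreover have "\<forall>e\<in>(\<Union>M\<in>H. C M). inj_on part' e"
  proof
    fix e assume "e \<in> (\<Union>M\<in>H. C M)"
    then obtain M d where d: "d \<in> E" "e = \<psi> M ` d" unfolding C_def by blast
    then have "inj_on part d" using P(3) by blast
    then show "inj_on part' e" unfolding d(2) inj_on_def by (auto simp: part')
  qed
  moreover have "part' ` V' \<subseteq> {..<a}" using P(4) ja unfolding V'_def by (auto simp: part')
  moreover have "mono_edge (\<Union>M\<in>H. C M) c"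
    if c: "card (c ` V') \<le> n"
      "\<forall>u\<in>V'. \<forall>v\<in>V'. part' u = part' v \<longrightarrow> Suc j \<le> part' u \<longrightarrow> c u = c v" for c
  proof -
    have finV': "finite V'" using finV finY finH unfolding V'_def by blast
    have "(c \<circ> top) ` Y \<subseteq> c ` V'" unfolding V'_def by auto
    then have "card ((c \<circ> top) ` Y) \<le> n" using c(1) finV' by (meson card_mono finite_imageI le_trans)
    then obtain M b where M: "M \<in> H" "\<forall>v\<in>M. c (top v) = b"
      using H(3) unfolding mono_edge_def by (metis comp_apply)
    have sub: "\<psi> M ` V \<subseteq> V'" using M unfolding V'_def by blast
    then have "(c \<circ> \<psi> M) ` V \<subseteq> c ` V'" by auto
    then have "card ((c \<circ> \<psi> M) ` V) \<le> n" using c(1) finV' by (meson card_mono finite_imageI le_trans)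
    moreover have "(c \<circ> \<psi> M) u = (c \<circ> \<psi> M) v" if uv: "u \<in> V" "v \<in> V" "part u = part v" "j \<le> part u" for u v
    proof (cases "part u = j")
      case True
      then show ?thesis using M \<phi>M uv unfolding \<psi>_def by simp
    next
      case False
      then have "Suc j \<le> part' (\<psi> M u)" "part' (\<psi> M u) = part' (\<psi> M v)" using uv part' by auto
      then show ?thesis using c(2) sub uv by auto
    qed
    ultimately obtain e b' where e: "e \<in> E" "\<forall>v\<in>e. (c \<circ> \<psi> M) v = b'"
      using P(5)[of "c \<circ> \<psi> M"] unfolding mono_edge_def by blast
    then have "\<forall>v\<in>\<psi> M ` e. c v = b'" "\<psi> M ` e \<in> C M" unfolding C_def by auto
    then show ?thesis using M unfolding mono_edge_def by blast
  qed
  ultimately have "partite_system k n (Suc p) a (Suc j) V' (\<Union>M\<in>H. C M) part'"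
    unfolding partite_system_def by iprover
  then show thesis by (rule that)
qed

text \<open>For \<open>p = 0\<close> sparsity is void and all \<open>k\<close>-subsets are taken.
  For \<open>Suc p\<close>, an inner induction on \<open>j\<close> applies one partite step per
  part, each gluing along a hypergraph obtained for \<open>p\<close>.\<close>

lemma sparse_ramsey_hypergraph_exists:
  "\<exists>V E. ramsey_hypergraph k p n V E"
proof (induction p arbitrary: k)
  case 0
  let ?V = "{..<k * n + k}"
  let ?E = "{S. S \<subseteq> ?V \<and> card S = k}"
  have "mono_edge ?E c" if c: "card (c ` ?V) \<le> n" for c
  proof -
    have "k * n + k \<le> card ?V" by simp
    from pigeonhole_subset[OF finite_lessThan c this]
    obtain S where S: "S \<subseteq> ?V" "card S = k" "\<exists>a. \<forall>i\<in>S. c i = a" .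
    then have "S \<in> ?E" by simp
    with S(3) show ?thesis unfolding mono_edge_def by (rule bexI)
  qed
  moreover have "sparse 0 ?E" unfolding sparse_def by auto
  moreover have "uniform_hypergraph k ?V ?E" unfolding uniform_hypergraph_def by auto
  ultimately have "ramsey_hypergraph k 0 n ?V ?E" unfolding ramsey_hypergraph_def by iprover
  then show ?case by iprover
next
  case (Suc p)
  note IH = Suc.IH
  let ?a = "k * n + k"
  have "j \<le> ?a \<Longrightarrow> \<exists>V E part. partite_system k n (Suc p) ?a j V E part" for j
  proof (induction j)
    case 0
    show ?case using partite_start by metis
  next
    case (Suc j)
    then obtain V E part where "partite_system k n (Suc p) ?a j V E part" using Suc_leD by metis
    then show ?case using partite_step[OF IH] Suc.prems by (metis Suc_le_lessD)
  qed
  from this[of ?a] obtain V E part where *: "partite_system k n (Suc p) ?a ?a V E part" by (metis order_refl)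
  have "mono_edge E c" if "card (c ` V) \<le> n" for c
  proof -
    have "\<forall>u\<in>V. \<forall>v\<in>V. part u = part v \<longrightarrow> ?a \<le> part u \<longrightarrow> c u = c v"
      using * unfolding partite_system_def by fastforce
    then show ?thesis using * that unfolding partite_system_def by metis
  qed
  then have "ramsey_hypergraph k (Suc p) n V E"
    using * unfolding partite_system_def ramsey_hypergraph_def by iprover
  then show ?case by iprover
qed

section \<open>Hasse diagrams of planar point sets\<close>

text \<open>The vertex \<open>v\<close> is the point \<open>(v, b v)\<close> of the plane.\<close>

locale planar_hasse_graph =
  fixes p r :: nat and V :: "nat set" and E :: "(nat \<times> nat) set" and b :: "nat \<Rightarrow> nat"
  assumes finite_vertices: "finite V" and inj_b: "inj_on b V"
    and edgeD: "(u, v) \<in> E \<Longrightarrow> u \<in> V \<and> v \<in> V \<and> u < v \<and> b u < b v"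
    and empty_rectangle: "(u, v) \<in> E \<Longrightarrow> w \<in> V \<Longrightarrow> \<not> (u < w \<and> w < v \<and> b u < b w \<and> b w < b v)"
    and sparse_edges: "sparse p ((\<lambda>(u, v). {u, v}) ` E)"
    and ex_level: "\<exists>h :: nat \<Rightarrow> nat. (\<forall>v\<in>V. h v < r) \<and> (\<forall>u v. (u, v) \<in> E \<longrightarrow> h u < h v)"
    and colours: "(\<And>u v. (u, v) \<in> E \<Longrightarrow> c u \<noteq> c v) \<Longrightarrow> r \<le> card ((c :: nat \<Rightarrow> nat) ` V)"
    and ex_chain: "\<exists>K t. K \<subseteq> V \<and> t \<in> K \<and> card K = r \<and> (\<forall>x\<in>K. (x, t) \<in> E\<^sup>*) \<and>
      (\<forall>x\<in>K. \<forall>y\<in>K. (x, y) \<in> E\<^sup>* \<or> (y, x) \<in> E\<^sup>*)"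

lemma planar_hasse_graph_1: "planar_hasse_graph p 1 {0} {} id"
proof
  show "\<exists>K t. K \<subseteq> {0 :: nat} \<and> t \<in> K \<and> card K = 1 \<and> (\<forall>x\<in>K. (x, t) \<in> {}\<^sup>*) \<and>
      (\<forall>x\<in>K. \<forall>y\<in>K. (x, y) \<in> {}\<^sup>* \<or> (y, x) \<in> {}\<^sup>*)"
    by (intro exI[of _ "{0}"] exI[of _ 0]) auto
  show "sparse p ((\<lambda>(u, v). {u, v}) ` {})" unfolding sparse_def by simp
qed auto

text \<open>The increasing enumerations of the two sets are composed. This puts the vertices of a
  copy into the columns of a hyperedge in their old left-to-right order.\<close>

lemma monotone_bijection:
  fixes V M :: "nat set"
  assumes "finite V" "finite M" "card V = card M"
  obtains f where "bij_betw f V M" "strict_mono_on V f"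
proof -
  obtain g where g: "bij_betw g {..<card V} V" "strict_mono_on {..<card V} g"
    using ex_bij_betw_strict_mono_card assms(1) by blast
  obtain h where h: "bij_betw h {..<card V} M" "strict_mono_on {..<card V} h"
    using ex_bij_betw_strict_mono_card[OF assms(2)] assms(3) by metis
  define g' where "g' = inv_into {..<card V} g"
  have g': "bij_betw g' V {..<card V}" unfolding g'_def by (rule bij_betw_inv_into[OF g(1)])
  have gg': "g (g' v) = v" "g' v < card V" if "v \<in> V" for v
    using that g(1) g' unfolding g'_def bij_betw_def by (auto simp: f_inv_into_f)
  have "strict_mono_on V (h \<circ> g')"
  proof (rule strict_mono_onI)
    fix u v assume uv: "u \<in> V" "v \<in> V" "u < v"
    have "g' u < g' v"
    proof (rule ccontr)
      assume "\<not> g' u < g' v"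
      then have "g' v \<le> g' u" by simp
      then have "g (g' v) \<le> g (g' u)"
        using strict_mono_on_leD[OF g(2), of "g' v" "g' u"] gg' uv by simp
      then show False using gg' uv by simp
    qed
    then show "(h \<circ> g') u < (h \<circ> g') v" using h(2) gg' uv by (simp add: strict_mono_onD)
  qed
  then show thesis using that bij_betw_trans[OF g' h(1)] by blast
qed

text \<open>Lexicographic order on pairs of a strip \<open>s\<close> and an offset \<open>i\<close>.
  The offset \<open>i'\<close> in the upper strip may be arbitrarily large, as happens for top
  points.\<close>

lemma stacked_less:
  fixes s i :: nat
  assumes "i < B" "s < s'"
  shows "s * B + i < s' * B + i'"
proof -
  have "s * B + i < Suc s * B" using assms(1) by simp
  also have "\<dots> \<le> s' * B" using assms(2) by (intro mult_le_mono1) simp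
  finally show ?thesis by simp
qed

lemma stacked_lessD:
  fixes s i :: nat
  assumes "i' < B" "s * B + i < s' * B + i'"
  shows "s < s' \<or> s = s' \<and> i < i'"
  using assms stacked_less[of i' B s' s i] by (cases s s' rule: linorder_cases) auto

text \<open>The copy of \<open>E\<close> for a hyperedge \<open>M\<close> lies in the horizontal strip numbered
  \<open>set_encode M\<close>, its vertices in the columns given by the elements of \<open>M\<close>. Within a column,
  higher strips lie further to the left and the new top point is the rightmost one, so the rectangle
  between a vertex of a copy and its top point, which stays within the column, is empty.\<close>

lemma planar_hasse_graph_Suc:
  assumes "planar_hasse_graph p r V E b" "0 < r"
  obtains V' E' b' where "planar_hasse_graph p (Suc r) V' E' b'"
proof -
  interpret planar_hasse_graph p r V E b by (rule assms(1))
  obtain h :: "nat \<Rightarrow> nat" where h: "\<And>v. v \<in> V \<Longrightarrow> h v < r" "\<And>u v. (u, v) \<in> E \<Longrightarrow> h u < h v"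
    using ex_level by metis
  obtain K t where K: "K \<subseteq> V" "t \<in> K" "card K = r" "\<And>x. x \<in> K \<Longrightarrow> (x, t) \<in> E\<^sup>*"
    "\<And>x y. x \<in> K \<Longrightarrow> y \<in> K \<Longrightarrow> (x, y) \<in> E\<^sup>* \<or> (y, x) \<in> E\<^sup>*"
    using ex_chain by metis
  obtain X H where "ramsey_hypergraph (card V) p r X H"
    using sparse_ramsey_hypergraph_exists by blast
  then have finX: "finite X" and HX: "\<And>M. M \<in> H \<Longrightarrow> M \<subseteq> X" "\<And>M. M \<in> H \<Longrightarrow> card M = card V"
    and spH: "sparse p H" and mono: "\<And>c. card (c ` X) \<le> r \<Longrightarrow> mono_edge H c"
    unfolding ramsey_hypergraph_def uniform_hypergraph_def by auto
  have finM: "finite M" if "M \<in> H" for M using that HX(1) finX finite_subset by blast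
  have finH: "finite H" using finX HX(1) by (meson Pow_iff finite_Pow_iff finite_subset subsetI)
  \<comment> \<open>\<open>m\<close> exceeds all hyperedge codes: it is the number of strips and the
    height at which the top points start.\<close>
  obtain m where m: "\<And>M. M \<in> H \<Longrightarrow> set_encode M < m"
    using finite_nat_set_iff_bounded[of "set_encode ` H"] finH by auto
  obtain B where B: "\<And>v. v \<in> V \<Longrightarrow> b v < B"
    using finite_nat_set_iff_bounded[of "b ` V"] finite_vertices by auto
  have "\<exists>f. bij_betw f V M \<and> strict_mono_on V f" if "M \<in> H" for M
    using monotone_bijection[OF finite_vertices finM[OF that]] HX(2)[OF that] by metis
  then obtain \<phi> where \<phi>: "\<And>M. M \<in> H \<Longrightarrow> bij_betw (\<phi> M) V M" "\<And>M. M \<in> H \<Longrightarrow> strict_mono_on V (\<phi> M)"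
    by metis
  have \<phi>M: "\<phi> M v \<in> M" if "M \<in> H" "v \<in> V" for M v
    using \<phi>(1) that bij_betwE by blast
  have \<phi>inv: "inv_into V (\<phi> M) (\<phi> M v) = v" if "M \<in> H" "v \<in> V" for M v
    by (rule bij_betw_inv_into_left[OF \<phi>(1)[OF that(1)] that(2)])
  have \<phi>less: "u < v" if "M \<in> H" "u \<in> V" "v \<in> V" "\<phi> M u < \<phi> M v" for M u v
    using strict_mono_on_less[OF \<phi>(2)] that by auto
  have \<phi>mono: "\<phi> M u < \<phi> M v" if "M \<in> H" "u \<in> V" "v \<in> V" "u < v" for M u v
    using strict_mono_on_less[OF \<phi>(2)] that by auto

  \<comment> \<open>Coordinates of the new points\<close>
  define N where "N = Suc m"
  have mN: "m < N" unfolding N_def by simp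
  have divmod: "(x * N + k) mod N = k" "(x * N + k) div N = x" if "k < N" for x k
    using that by simp_all
  \<comment> \<open>A column is \<open>N\<close> wide: positions below \<open>m\<close> belong to
    the strips in reverse order, position \<open>m\<close> to the top point. Since
    \<open>set_encode M < m\<close>, the subtraction never truncates and distinct strips get
    distinct positions.\<close>
  define \<psi> where "\<psi> M v = \<phi> M v * N + (m - Suc (set_encode M))" for M v
  define top where "top x = x * N + m" for x
  define V' where "V' = top ` X \<union> (\<Union>M\<in>H. \<psi> M ` V)"
  define E' where "E' = {(\<psi> M u, \<psi> M v) | M u v. M \<in> H \<and> (u, v) \<in> E} \<union>
    {(\<psi> M v, top (\<phi> M v)) | M v. M \<in> H \<and> v \<in> V}"
  \<comment> \<open>The residue modulo \<open>N\<close> recovers the strip and the quotient the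
    column, so \<open>code\<close> and \<open>base\<close> invert \<open>\<psi>\<close> and allow
    \<open>b'\<close> and \<open>h'\<close> to be defined on plain numbers.\<close>
  define code where "code w = m - Suc (w mod N)" for w
  define base where "base w = inv_into V (\<phi> (set_decode (code w))) (w div N)" for w
  define b' where "b' w = (if w mod N = m then m * B + w div N else code w * B + b (base w))" for w
  define h' where "h' w = (if w mod N = m then r else h (base w))" for w
  have top_simps: "top x mod N = m" "top x div N = x" for x
    unfolding top_def using divmod[OF mN] by auto
  have \<psi>mod: "\<psi> M v mod N = m - Suc (set_encode M)" "\<psi> M v div N = \<phi> M v" for M v
    unfolding \<psi>_def using mN by (intro divmod; simp)+
  have code: "code (\<psi> M v) = set_encode M" if "M \<in> H" for M v
    using m[OF that] unfolding code_def \<psi>mod by simp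
  have base: "base (\<psi> M v) = v" if "M \<in> H" "v \<in> V" for M v
    unfolding base_def code[OF that(1)] \<psi>mod using \<phi>inv that finM by simp
  have b'_top: "b' (top x) = m * B + x" for x unfolding b'_def top_simps by simp
  have h'_top: "h' (top x) = r" for x unfolding h'_def top_simps by simp
  have \<psi>ne: "\<psi> M v mod N \<noteq> m" if "M \<in> H" for M v
    using m[OF that] unfolding \<psi>mod by simp
  have b'_\<psi>: "b' (\<psi> M v) = set_encode M * B + b v" if "M \<in> H" "v \<in> V" for M v
    using \<psi>ne code base that unfolding b'_def by simp
  have h'_\<psi>: "h' (\<psi> M v) = h v" if "M \<in> H" "v \<in> V" for M v
    using \<psi>ne base that unfolding h'_def by simp
  have \<psi>top: "\<psi> M v \<noteq> top x" if "M \<in> H" for M v x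
    using \<psi>ne[OF that] top_simps by metis
  have enc: "M = M'" if "M \<in> H" "M' \<in> H" "set_encode M = set_encode M'" for M M'
    using that finM set_encode_eq by blast
  have \<psi>eq: "M = M' \<and> u = v" if "M \<in> H" "M' \<in> H" "u \<in> V" "v \<in> V" "\<psi> M u = \<psi> M' v" for M M' u v
    using that code base enc by metis
  have top_inj: "inj top" using top_simps(2) by (metis injI)
  have \<psi>inj: "inj_on (\<psi> M) V" if "M \<in> H" for M using \<psi>eq that by (metis inj_onI)
  have V'_cases: thesis
    if "w \<in> V'" "\<And>x. x \<in> X \<Longrightarrow> w = top x \<Longrightarrow> thesis"
      "\<And>M v. M \<in> H \<Longrightarrow> v \<in> V \<Longrightarrow> w = \<psi> M v \<Longrightarrow> thesis" for w thesis
    using that unfolding V'_def by blast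
  have E'_cases: thesis
    if "(x, y) \<in> E'" "\<And>M u v. M \<in> H \<Longrightarrow> (u, v) \<in> E \<Longrightarrow> x = \<psi> M u \<Longrightarrow> y = \<psi> M v \<Longrightarrow> thesis"
      "\<And>M v. M \<in> H \<Longrightarrow> v \<in> V \<Longrightarrow> x = \<psi> M v \<Longrightarrow> y = top (\<phi> M v) \<Longrightarrow> thesis" for x y thesis
    using that unfolding E'_def by blast
  have V'I: "x \<in> X \<Longrightarrow> top x \<in> V'" "M \<in> H \<Longrightarrow> v \<in> V \<Longrightarrow> \<psi> M v \<in> V'" for x M v
    unfolding V'_def by auto
  have E'I: "M \<in> H \<Longrightarrow> (u, v) \<in> E \<Longrightarrow> (\<psi> M u, \<psi> M v) \<in> E'"
    "M \<in> H \<Longrightarrow> v \<in> V \<Longrightarrow> (\<psi> M v, top (\<phi> M v)) \<in> E'" for M u v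
    unfolding E'_def by blast+
  have \<phi>X: "\<phi> M v \<in> X" if "M \<in> H" "v \<in> V" for M v using \<phi>M HX(1) that by blast
  have \<psi>_below_top: "\<psi> M v < top x \<longleftrightarrow> \<phi> M v \<le> x" if "M \<in> H" for M v x
  proof (cases "\<phi> M v" x rule: linorder_cases)
    case less
    then show ?thesis unfolding \<psi>_def top_def using mN stacked_less[of "m - Suc (set_encode M)" N "\<phi> M v" x m] by simp
  next
    case equal
    then show ?thesis unfolding \<psi>_def top_def using m[OF that] by simp
  next
    case greater
    then show ?thesis unfolding \<psi>_def top_def
      using stacked_less[OF mN, of x "\<phi> M v" "m - Suc (set_encode M)"] by simp
  qed
  have b'_\<psi>_less: "b' (\<psi> M v) < m * B + i" if "M \<in> H" "v \<in> V" for M v i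
    unfolding b'_\<psi>[OF that] using stacked_less[OF B m] that by auto
  have finV': "finite V'" using finite_vertices finX finH unfolding V'_def by blast
  have injb': "inj_on b' V'"
  proof (rule inj_onI)
    fix w w' assume w: "w \<in> V'" "w' \<in> V'" "b' w = b' w'"
    show "w = w'"
    proof (rule V'_cases[OF w(1)]; rule V'_cases[OF w(2)])
      fix x x' assume "w = top x" "w' = top x'"
      then show "w = w'" using w(3) b'_top by simp
    next
      fix x M v assume "w = top x" "M \<in> H" "v \<in> V" "w' = \<psi> M v"
      then show "w = w'" using w(3) b'_top b'_\<psi>_less[of M v x] by simp
    next
      fix x M v assume "w' = top x" "M \<in> H" "v \<in> V" "w = \<psi> M v"
      then show "w = w'" using w(3) b'_top b'_\<psi>_less[of M v x] by simp
    next
      fix M v M' v' assume *: "M \<in> H" "v \<in> V" "w = \<psi> M v" "M' \<in> H" "v' \<in> V" "w' = \<psi> M' v'"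
      then have eq: "set_encode M * B + b v = set_encode M' * B + b v'" using w(3) b'_\<psi> by simp
      have "set_encode M = set_encode M'"
        using eq stacked_less[OF B] * by (metis linorder_neqE_nat less_irrefl)
      then have "M = M'" using enc * by blast
      then have "b v = b v'" using eq by simp
      then have "v = v'" using * inj_b by (auto dest: inj_onD)
      then show "w = w'" using * \<open>M = M'\<close> by simp
    qed
  qed

  \<comment> \<open>Empty rectangles\<close>
  have edges: "u \<in> V' \<and> v \<in> V' \<and> u < v \<and> b' u < b' v \<and>
      (\<forall>w\<in>V'. \<not> (u < w \<and> w < v \<and> b' u < b' w \<and> b' w < b' v))" if uv: "(u, v) \<in> E'" for u v
  proof (rule E'_cases[OF uv])
    fix M y z assume M: "M \<in> H" "(y, z) \<in> E" "u = \<psi> M y" "v = \<psi> M z"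
    have yz: "y \<in> V" "z \<in> V" "y < z" "b y < b z" using edgeD M(2) by auto
    have "u < v" using \<phi>mono[OF M(1)] yz M mN unfolding \<psi>_def by simp
    moreover have "b' u < b' v" using b'_\<psi> yz M by simp
    moreover have False
      if w: "w \<in> V'" "u < w" "w < v" "b' u < b' w" "b' w < b' v" for w
    proof (rule V'_cases[OF w(1)])
      fix x assume "w = top x"
      then show False using w(5) b'_top b'_\<psi>_less[OF M(1) yz(2)] M(4)
        by (metis less_asym)
    next
      fix M' w' assume w': "M' \<in> H" "w' \<in> V" "w = \<psi> M' w'"
      \<comment> \<open>Both ends of the edge lie in one strip, so \<open>w\<close> lies in that
        strip and hence in the same copy, against the empty rectangle of
        \<open>(y, z)\<close>.\<close>
      have "set_encode M * B + b y < set_encode M' * B + b w'"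
        "set_encode M' * B + b w' < set_encode M * B + b z"
        using w b'_\<psi> M yz w' by auto
      then have "set_encode M = set_encode M'" "b y < b w'" "b w' < b z"
        using stacked_lessD[OF B[OF w'(2)], of "set_encode M" "b y" "set_encode M'"]
          stacked_lessD[OF B[OF yz(2)], of "set_encode M'" "b w'" "set_encode M"] by linarith+
      moreover from this have "M' = M" using enc M w' by blast
      moreover from this have "\<phi> M y < \<phi> M w'" "\<phi> M w' < \<phi> M z"
        using w M w' unfolding \<psi>_def by simp_all
      then have "y < w'" "w' < z" using \<phi>less M(1) yz w' by auto
      ultimately show False using empty_rectangle M w w' by blast
    qed
    ultimately show ?thesis using V'I M yz by blast
  next
    fix M y assume M: "M \<in> H" "y \<in> V" "u = \<psi> M y" "v = top (\<phi> M y)"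
    have "u < v" using \<psi>_below_top M by simp
    moreover have "b' u < b' v" using b'_\<psi>_less M b'_top by simp
    moreover have False
      if w: "w \<in> V'" "u < w" "w < v" "b' u < b' w" for w
    proof (rule V'_cases[OF w(1)])
      fix x assume x: "w = top x"
      then have "\<phi> M y \<le> x" using w(2) \<psi>_below_top M by simp
      moreover have "x < \<phi> M y" using w(3) x M unfolding top_def by simp
      ultimately show False by simp
    next
      fix M' w' assume w': "M' \<in> H" "w' \<in> V" "w = \<psi> M' w'"
      have "\<phi> M' w' \<le> \<phi> M y" using w(3) w' M \<psi>_below_top by simp
      moreover have "\<phi> M y * N + (m - Suc (set_encode M)) < \<phi> M' w' * N + (m - Suc (set_encode M'))"
        using w(2) unfolding w'(3) M(3) \<psi>_def .
      then have "\<phi> M y < \<phi> M' w' \<or> \<phi> M y = \<phi> M' w' \<and> m - Suc (set_encode M) < m - Suc (set_encode M')"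
        using mN by (intro stacked_lessD[of _ N]) simp_all
      ultimately have "set_encode M' < set_encode M" by linarith
      then have "b' w < b' u" using stacked_less[OF B] w' M b'_\<psi> by simp
      then show False using w(4) by simp
    qed
    ultimately show ?thesis using V'I M \<phi>X by blast
  qed

  \<comment> \<open>Sparsity of the new graph\<close>
  define C where "C M = (\<lambda>(u, v). {\<psi> M u, \<psi> M v}) ` E \<union> (\<lambda>v. {\<psi> M v, top (\<phi> M v)}) ` V" for M
  have "sparse p (\<Union>M\<in>H. C M)"
  proof (rule sparse_amalgam[where A = "\<lambda>M. top ` M" and q = p])
    fix M M' e e' assume M: "M \<in> H" "M' \<in> H" "M \<noteq> M'" and e: "e \<in> C M" "e' \<in> C M'"
    have sub: "d \<subseteq> \<psi> N ` V \<union> top ` N" if "N \<in> H" "d \<in> C N" for d N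
      using that edgeD \<phi>M unfolding C_def by auto
    show "e \<inter> e' \<subseteq> top ` M \<inter> top ` M'"
    proof
      fix w assume w: "w \<in> e \<inter> e'"
      then have "w \<in> \<psi> M ` V \<or> w \<in> top ` M" "w \<in> \<psi> M' ` V \<or> w \<in> top ` M'"
        using sub[OF M(1) e(1)] sub[OF M(2) e(2)] by auto
      then show "w \<in> top ` M \<inter> top ` M'" using \<psi>eq \<psi>top M by (metis IntI imageE)
    qed
  next
    fix M assume M: "M \<in> H"
    have "inj_on (\<psi> M) (\<Union>((\<lambda>(u, v). {u, v}) ` E))"
      using edgeD by (intro inj_on_subset[OF \<psi>inj[OF M]]) auto
    from sparse_image[OF sparse_edges this]
    have "sparse p ((\<lambda>(u, v). {\<psi> M u, \<psi> M v}) ` E)"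
      by (simp add: image_image case_prod_beta)
    then show "sparse p (C M)" unfolding C_def
    proof (rule sparse_pendant)
      show "inj_on (\<lambda>v. top (\<phi> M v)) V"
        using inj_on_subset[OF top_inj subset_UNIV] \<phi>(1)[OF M]
        by (intro comp_inj_on[of "\<phi> M" V top, unfolded comp_def]) (auto simp: bij_betw_def)
      show "top (\<phi> M v) \<notin> \<Union> ((\<lambda>(u, v). {\<psi> M u, \<psi> M v}) ` E)" for v
        using \<psi>top[OF M, symmetric] by auto
      show "top (\<phi> M v) \<noteq> \<psi> M u" for u v using \<psi>top[OF M] by metis
    qed
  next
    fix M e assume M: "M \<in> H" "e \<in> C M"
    then consider u v where "e = {\<psi> M u, \<psi> M v}" | v where "e = {\<psi> M v, top (\<phi> M v)}"
      unfolding C_def by auto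
    \<comment> \<open>An edge inside a copy contains no top point, a matching edge only its
      own.\<close>
    then show "\<exists>x. e \<inter> top ` M \<subseteq> {x}"
    proof cases
      case 1
      then have "e \<inter> top ` M = {}" using \<psi>top[OF M(1)] by auto
      then show ?thesis by auto
    next
      case 2
      then have "e \<inter> top ` M \<subseteq> {top (\<phi> M v)}" using \<psi>top[OF M(1), symmetric] by auto
      then show ?thesis by blast
    qed
  next
    show "inj_on ((`) top) H" using top_inj by (simp add: inj_on_def inj_image_eq_iff)
    show "sparse p ((`) top ` H)"
      by (rule sparse_image[OF spH]) (rule inj_on_subset[OF top_inj subset_UNIV])
  qed simp
  moreover have "(\<lambda>(u, v). {u, v}) ` E' \<subseteq> (\<Union>M\<in>H. C M)"
  proof
    fix e assume "e \<in> (\<lambda>(u, v). {u, v}) ` E'"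
    then obtain u v where e: "(u, v) \<in> E'" "e = {u, v}" by auto
    show "e \<in> (\<Union>M\<in>H. C M)"
    proof (rule E'_cases[OF e(1)])
      fix M y z assume "M \<in> H" "(y, z) \<in> E" "u = \<psi> M y" "v = \<psi> M z"
      then show ?thesis using e(2) unfolding C_def by force
    next
      fix M y assume "M \<in> H" "y \<in> V" "u = \<psi> M y" "v = top (\<phi> M y)"
      then show ?thesis using e(2) unfolding C_def by auto
    qed
  qed
  ultimately have sp': "sparse p ((\<lambda>(u, v). {u, v}) ` E')" by (rule sparse_mono)

  \<comment> \<open>Levels, colours and a longest chain\<close>
  have height: "(\<forall>v\<in>V'. h' v < Suc r) \<and> (\<forall>u v. (u, v) \<in> E' \<longrightarrow> h' u < h' v)"
  proof (intro conjI ballI allI impI)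
    fix v assume v: "v \<in> V'"
    show "h' v < Suc r" by (rule V'_cases[OF v]) (use h(1) h'_top h'_\<psi> in \<open>auto simp: less_SucI\<close>)
  next
    fix u v assume uv: "(u, v) \<in> E'"
    show "h' u < h' v"
      by (rule E'_cases[OF uv]) (use h edgeD h'_top h'_\<psi> in auto)
  qed
  have chrom': "Suc r \<le> card (c ` V')" if c: "\<And>u v. (u, v) \<in> E' \<Longrightarrow> c u \<noteq> c v" for c :: "nat \<Rightarrow> nat"
  proof (rule ccontr)
    assume "\<not> Suc r \<le> card (c ` V')"
    then have small: "card (c ` V') \<le> r" by simp
    have "(c \<circ> top) ` X \<subseteq> c ` V'" using V'I by auto
    then have "card ((c \<circ> top) ` X) \<le> r"
      using small finV' by (meson card_mono finite_imageI le_trans)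
    then obtain M a where M: "M \<in> H" "\<And>x. x \<in> M \<Longrightarrow> c (top x) = a"
      using mono unfolding mono_edge_def by (metis comp_apply)
    have "r \<le> card ((c \<circ> \<psi> M) ` V)"
      by (rule colours) (use c E'I(1) M(1) in auto)
    also have "(c \<circ> \<psi> M) ` V \<subseteq> c ` V' - {a}"
    proof
      fix x assume "x \<in> (c \<circ> \<psi> M) ` V"
      then obtain v where v: "v \<in> V" "x = c (\<psi> M v)" by auto
      have "c (\<psi> M v) \<noteq> c (top (\<phi> M v))" using c E'I(2) M(1) v by blast
      then show "x \<in> c ` V' - {a}" using M \<phi>M v V'I by auto
    qed
    then have "card ((c \<circ> \<psi> M) ` V) \<le> card (c ` V' - {a})" using finV' by (intro card_mono) auto
    \<comment> \<open>\<open>t \<in> K\<close> makes \<open>V\<close> and hence \<open>M\<close>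
      nonempty, so \<open>a\<close> really occurs and counts as one more colour than those of the
      copy.\<close>
    also have "a \<in> c ` V'" using M \<phi>M[OF M(1)] \<phi>X[OF M(1)] K V'I(1) by (metis imageI subsetD)
    then have "card (c ` V' - {a}) < card (c ` V')" using finV' by (intro card_Diff1_less) auto
    finally show False using small by simp
  qed
  \<comment> \<open>The Ramsey property for a constant colouring yields a hyperedge, and so a copy
    to carry the new chain.\<close>
  have "card ((\<lambda>_. 0 :: nat) ` X) \<le> r"
    using card_mono[of "{0}" "(\<lambda>_. 0 :: nat) ` X"] assms(2) by (simp add: image_subset_iff)
  then obtain M where M: "M \<in> H" using mono unfolding mono_edge_def by blast
  \<comment> \<open>\<open>t\<close> is the greatest element of the old chain, so its top point lies
    above the whole lifted chain and becomes the new greatest element.\<close>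
  let ?t = "top (\<phi> M t)"
  let ?K = "insert ?t (\<psi> M ` K)"
  have tV: "t \<in> V" using K by blast
  have lift: "(\<psi> M x, \<psi> M y) \<in> E'\<^sup>*" if "(x, y) \<in> E\<^sup>*" for x y
    using that
  proof induction
    case (step y z)
    then show ?case using E'I(1)[OF M] by (meson rtrancl.rtrancl_into_rtrancl)
  qed simp
  have reach: "(x, ?t) \<in> E'\<^sup>*" if "x \<in> ?K" for x
    using that K(4) lift E'I(2)[OF M tV] by (auto intro: rtrancl_into_rtrancl)
  have "card ?K = Suc r"
  proof -
    have "card (\<psi> M ` K) = r" using \<psi>inj[OF M] K by (simp add: card_image inj_on_subset)
    moreover have "?t \<notin> \<psi> M ` K" using \<psi>top[OF M] by (metis imageE)
    moreover have "finite K" using K finite_vertices finite_subset by blast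
    ultimately show ?thesis by simp
  qed
  moreover have "?K \<subseteq> V'" using K M tV V'I \<phi>X by auto
  moreover have "(x, y) \<in> E'\<^sup>* \<or> (y, x) \<in> E'\<^sup>*" if "x \<in> ?K" "y \<in> ?K" for x y
    using that reach K(5) lift by blast
  ultimately have chain: "\<exists>K t. K \<subseteq> V' \<and> t \<in> K \<and> card K = Suc r \<and> (\<forall>x\<in>K. (x, t) \<in> E'\<^sup>*) \<and>
        (\<forall>x\<in>K. \<forall>y\<in>K. (x, y) \<in> E'\<^sup>* \<or> (y, x) \<in> E'\<^sup>*)"
    using reach by (intro exI[of _ ?K] exI[of _ ?t]) blast
  have "planar_hasse_graph p (Suc r) V' E' b'"
  proof (rule planar_hasse_graph.intro)
    show "finite V'" "inj_on b' V'" "sparse p ((\<lambda>(u, v). {u, v}) ` E')"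
      by (fact finV' injb' sp')+
    show "u \<in> V' \<and> v \<in> V' \<and> u < v \<and> b' u < b' v" if "(u, v) \<in> E'" for u v
      using edges[OF that] by simp
    show "\<not> (u < w \<and> w < v \<and> b' u < b' w \<and> b' w < b' v)" if "(u, v) \<in> E'" "w \<in> V'" for u v w
      using edges[OF that(1)] that(2) by simp
    show "\<exists>h :: nat \<Rightarrow> nat. (\<forall>v\<in>V'. h v < Suc r) \<and> (\<forall>u v. (u, v) \<in> E' \<longrightarrow> h u < h v)"
      using height by (rule exI[of _ h'])
    show "Suc r \<le> card ((c :: nat \<Rightarrow> nat) ` V')" if "\<And>u v. (u, v) \<in> E' \<Longrightarrow> c u \<noteq> c v" for c
      using that by (rule chrom')
    show "\<exists>K t. K \<subseteq> V' \<and> t \<in> K \<and> card K = Suc r \<and> (\<forall>x\<in>K. (x, t) \<in> E'\<^sup>*) \<and>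
        (\<forall>x\<in>K. \<forall>y\<in>K. (x, y) \<in> E'\<^sup>* \<or> (y, x) \<in> E'\<^sup>*)"
      by (fact chain)
  qed
  then show thesis by (rule that)
qed

lemma planar_hasse_graph_exists:
  assumes "0 < r"
  shows "\<exists>V E b. planar_hasse_graph p r V E b"
  using assms
proof (induction r rule: nat_induct_non_zero)
  case 1
  show ?case using planar_hasse_graph_1 by blast
next
  case (Suc r)
  then show ?case using planar_hasse_graph_Suc by metis
qed

section \<open>The poset generated by a drawing\<close>

lemma linear_order_on_inj:
  fixes f :: "'a \<Rightarrow> 'b :: linorder"
  assumes "inj_on f V"
  shows "linear_order_on V {(x, y). x \<in> V \<and> y \<in> V \<and> f x \<le> f y}"
  using assms
  by (auto simp: linear_order_on_def partial_order_on_def preorder_on_def refl_on_def trans_def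
      antisym_def total_on_def dest: inj_onD)

theorem theorem2p7:
  fixes g r :: nat
  assumes "0 < g" and "0 < r"
  shows "\<exists>(V :: nat set) (R :: nat rel). finite V \<and> partial_order_on V R \<and>
    (let E = cover_edges V R in
       poset_height V R = r \<and>
       enat g \<le> girth V E \<and>
       chromatic_number V E = r \<and>
       eye V E \<le> 2 \<and>
       (\<exists>L1 L2. linear_extension V R L1 \<and> linear_extension V R L2 \<and>
          (\<forall>x\<in>V. \<forall>y\<in>V. \<forall>z\<in>V. distinct [x, y, z] \<and> {y, z} \<in> E \<longrightarrow>
             \<not> between_in L1 x y z \<or> \<not> between_in L2 x y z)))"
proof -
  obtain V E b where G: "planar_hasse_graph g r V E b"
    using planar_hasse_graph_exists[OF assms(2)] by blast
  interpret planar_hasse_graph g r V E b by (rule G)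
  obtain h :: "nat \<Rightarrow> nat" where h: "\<And>v. v \<in> V \<Longrightarrow> h v < r" "\<And>u v. (u, v) \<in> E \<Longrightarrow> h u < h v"
    using ex_level by metis
  obtain K where K: "K \<subseteq> V" "card K = r" "\<And>x y. x \<in> K \<Longrightarrow> y \<in> K \<Longrightarrow> (x, y) \<in> E\<^sup>* \<or> (y, x) \<in> E\<^sup>*"
    using ex_chain by metis
  define R where "R = {(x, y). x \<in> V \<and> y \<in> V \<and> (x, y) \<in> E\<^sup>*}"
  have up: "x \<in> V \<and> y \<in> V \<and> x < y \<and> b x < b y \<and> h x < h y" if "(x, y) \<in> E\<^sup>+" for x y
    using that
  proof induction
    case (base y)
    then show ?case using edgeD h by blast
  next
    case (step y z)
    then show ?case using edgeD[of y z] h(2)[of y z] by auto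
  qed
  have R_less: "(x, y) \<in> R - Id \<longleftrightarrow> (x, y) \<in> E\<^sup>+" for x y
  proof
    assume "(x, y) \<in> R - Id"
    then show "(x, y) \<in> E\<^sup>+" unfolding R_def by (auto simp: rtrancl_eq_or_trancl)
  next
    assume "(x, y) \<in> E\<^sup>+"
    then show "(x, y) \<in> R - Id" using up[of x y] unfolding R_def by auto
  qed
  have R_le: "x \<in> V \<and> y \<in> V \<and> x \<le> y \<and> b x \<le> b y" if "(x, y) \<in> R" for x y
    using that R_less[of x y] up[of x y] unfolding R_def by (cases "x = y") auto
  have po: "partial_order_on V R"
    unfolding partial_order_on_def preorder_on_def
  proof (intro conjI)
    show "R \<subseteq> V \<times> V" "refl_on V R" unfolding R_def refl_on_def by auto
    show "trans R" unfolding R_def trans_def by (auto intro: rtrancl_trans)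
    show "antisym R" using R_le by (auto intro!: antisymI dest!: R_le)
  qed
  \<comment> \<open>A point strictly between the ends of an edge in the order would be so in both
    coordinates, hence inside the empty rectangle; thus edges are covers. Conversely, the first step
    of a path of several edges would lie strictly between its ends.\<close>
  have covers: "poset_covers V R y x \<longleftrightarrow> (x, y) \<in> E" for x y
  proof
    assume c: "poset_covers V R y x"
    then have "(x, y) \<in> E\<^sup>+" unfolding poset_covers_def R_less by blast
    then obtain z where z: "(x, z) \<in> E" "(z, y) \<in> E\<^sup>*" by (meson tranclD)
    have "z = y"
    proof (rule ccontr)
      assume "z \<noteq> y"
      then have "(z, y) \<in> E\<^sup>+" using z by (simp add: rtrancl_eq_or_trancl)
      then show False using c z edgeD[OF z(1)] unfolding poset_covers_def R_less by blast
    qed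
    then show "(x, y) \<in> E" using z by simp
  next
    assume e: "(x, y) \<in> E"
    have "\<not> ((x, z) \<in> E\<^sup>+ \<and> (z, y) \<in> E\<^sup>+)" for z
      using empty_rectangle[OF e, of z] up[of x z] up[of z y] by blast
    then show "poset_covers V R y x" using edgeD[OF e] e unfolding poset_covers_def R_less by blast
  qed
  define D where "D = cover_edges V R"
  have D_eq: "D = (\<lambda>(u, v). {u, v}) ` E"
    unfolding D_def cover_edges_def covers by (auto simp: insert_commute)
  have edge: "(x, y) \<in> E \<or> (y, x) \<in> E" if "{x, y} \<in> D" for x y
    using that unfolding D_eq by (auto simp: doubleton_eq_iff)
  have DE: "{x, y} \<in> D" if "(x, y) \<in> E" for x y using that unfolding D_eq by force
  have height: "poset_height V R = r"
    unfolding poset_height_def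
  proof (rule Max_eqI)
    have "finite {C \<in> Chains R. C \<subseteq> V}" using finite_vertices by (auto intro: finite_subset[of _ "Pow V"])
    then show "finite (card ` {C \<in> Chains R. C \<subseteq> V})" by blast
    have "K \<in> Chains R" using K unfolding Chains_def R_def by blast
    then show "r \<in> card ` {C \<in> Chains R. C \<subseteq> V}" using K by auto
    fix n assume "n \<in> card ` {C \<in> Chains R. C \<subseteq> V}"
    then obtain C where C: "C \<in> Chains R" "C \<subseteq> V" "n = card C" by blast
    \<comment> \<open>Levels strictly increase along a chain, and there are only \<open>r\<close> of
      them.\<close>
    have "inj_on h C"
    proof (rule inj_onI, rule ccontr)
      fix x y assume xy: "x \<in> C" "y \<in> C" "h x = h y" "x \<noteq> y"
      then have "(x, y) \<in> R - Id \<or> (y, x) \<in> R - Id" using C unfolding Chains_def by blast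
      then show False using up[of x y] up[of y x] xy(3) unfolding R_less by auto
    qed
    moreover have "h ` C \<subseteq> {..<r}" using C h by auto
    ultimately show "n \<le> r" using C(3) card_inj_on_le[of h C "{..<r}"] by simp
  qed
  \<comment> \<open>The levels form a proper colouring with \<open>r\<close> colours;
    \<open>colours\<close> supplies the lower bound.\<close>
  have chromatic: "chromatic_number V D = r"
    unfolding chromatic_number_def
  proof (rule Least_equality)
    have "proper_colouring V D r h"
      unfolding proper_colouring_def
    proof (intro conjI ballI impI)
      show "h ` V \<subseteq> {..<r}" using h by auto
      show "h x \<noteq> h y" if "{x, y} \<in> D" for x y using edge[OF that] h(2) by force
    qed
    then show "\<exists>f. proper_colouring V D r f" by blast
    fix k assume "\<exists>f. proper_colouring V D k f"
    then obtain f where f: "f ` V \<subseteq> {..<k}" "\<forall>x\<in>V. \<forall>y\<in>V. {x, y} \<in> D \<longrightarrow> f x \<noteq> f y"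
      unfolding proper_colouring_def by blast
    have "r \<le> card (f ` V)" by (rule colours) (use f(2) edgeD DE in blast)
    then show "r \<le> k" using card_mono[OF _ f(1)] by simp
  qed
  have "enat (Suc g) \<le> girth V D" unfolding D_eq by (rule sparse_imp_girth[OF sparse_edges])
  then have girth: "enat g \<le> girth V D" by (meson enat_ord_simps(1) le_SucI order_refl order_trans)
  define L1 where "L1 = {(x, y). x \<in> V \<and> y \<in> V \<and> id x \<le> id y}"
  define L2 where "L2 = {(x, y). x \<in> V \<and> y \<in> V \<and> b x \<le> b y}"
  have lin: "linear_order_on V L1" "linear_order_on V L2"
    unfolding L1_def L2_def by (rule linear_order_on_inj, simp add: inj_b)+
  have "R \<subseteq> L1" "R \<subseteq> L2" unfolding L1_def L2_def using R_le by auto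
  then have ext: "linear_extension V R L1" "linear_extension V R L2"
    using lin unfolding linear_extension_def by auto
  have no_between: "\<not> (between_in L1 x u v \<and> between_in L2 x u v)"
    if x: "x \<in> V" "x \<noteq> u" "x \<noteq> v" and uv: "(u, v) \<in> E" for x u v
  proof
    assume "between_in L1 x u v \<and> between_in L2 x u v"
    then have "u \<le> x \<and> x \<le> v" "b u \<le> b x \<and> b x \<le> b v"
      using edgeD[OF uv] unfolding between_in_def L1_def L2_def by auto
    \<comment> \<open>Injectivity of \<open>b\<close> makes the betweenness strict in the second
      coordinate, as \<open>empty_rectangle\<close> requires.\<close>
    moreover have "b x \<noteq> b u" "b x \<noteq> b v" using x edgeD[OF uv] inj_b by (auto dest: inj_onD)
    ultimately show False using empty_rectangle[OF uv x(1)] x by auto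
  qed
  have sym: "between_in L x y z \<longleftrightarrow> between_in L x z y" for L :: "nat rel" and x y z
    unfolding between_in_def by blast
  have sep: "\<forall>x\<in>V. \<forall>y\<in>V. \<forall>z\<in>V. distinct [x, y, z] \<and> {y, z} \<in> D \<longrightarrow>
             \<not> between_in L1 x y z \<or> \<not> between_in L2 x y z"
    using edge no_between sym by (metis distinct_length_2_or_more)
  have "eye_witness V D [L1, L2]"
    unfolding eye_witness_def using lin sep by auto
  then have eye: "eye V D \<le> 2"
    unfolding eye_def by (intro Least_le) (auto intro!: exI[of _ "[L1, L2]"])
  show ?thesis
    using finite_vertices po height girth chromatic eye ext sep unfolding Let_def D_def by blast
qed

end
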